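(* Let $\ell\ge 1$ be an integer and let $0<a_1<a_2<\dots<a_\ell<\frac12$ be real numbers. Then there exists a unique (real) polynomial $p$ of degree $L:=4\ell+1$ that satisfies (i) $p(x)+p(1-x)=1$ for all $x\in\mathbb{R}$, (ii) $p(0)=p(a_i)=p'(a_i)=0$ for $i=1,2,\dots,\ell$, where $p'$ is the derivative of $p$. Moreover, the polynomial $p$ also satisfies (iii) $p'$ has exactly one zero in $(0,a_1)$, and exactly one zero in $(a_i,a_{i+1})$ for each $i=1,\dots,\ell-1$, and $p'(x)>0$ for all $x\in(a_\ell,\frac12]$ and for all $x\le 0$, (iv) $p(x)<0$ for all $x<0$, and $p(x)\ge 0$ for all $x\in[0,\frac12]$ with equality if and only if $x=0$ or $x=a_i$ for some $i$. *)

theory Defs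
  imports Complex_Main "HOL-Computational_Algebra.Polynomial"
begin

definition reflection_interpolant :: "nat \<Rightarrow> (nat \<Rightarrow> real) \<Rightarrow> real poly \<Rightarrow> bool" where
  "reflection_interpolant l a p \<longleftrightarrow>
     degree p = 4 * l + 1 \<and>
     (\<forall>x. poly p x + poly p (1 - x) = 1) \<and>
     poly p 0 = 0 \<and>
     (\<forall>i\<in>{1..l}. poly p (a i) = 0 \<and> poly (pderiv p) (a i) = 0)"

end

theory Submission
  imports Defs
begin

text \<open>
  Conditions (i) and (ii) together prescribe the values of \<open>p\<close> at the \<open>2l + 2\<close> points \<open>0\<close>, \<open>1\<close>, \<open>a i\<close>,
  \<open>1 - a i\<close> and its derivative at the \<open>2l\<close> points \<open>a i\<close>, \<open>1 - a i\<close>.  These are \<open>4l + 2\<close> Hermite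
  conditions, and a nonzero polynomial of degree at most \<open>4l + 1\<close> cannot satisfy the homogeneous ones
  (\<open>poly_eq_0_by_counting_zeros\<close>); so the Hermite interpolant, which exists by
  \<open>hermite_interpolation_exists\<close>, is unique.  It is symmetric because \<open>1 - p (1 - x)\<close> meets the same conditions.

  All qualitative claims come from counting critical points.  Besides the \<open>a i\<close>, Rolle's theorem gives
  one zero of \<open>p'\<close> in each of the \<open>l\<close> gaps between consecutive zeros \<open>0, a 1, \<dots>, a l\<close> of \<open>p\<close>.
  Together with their mirror images this makes \<open>4l\<close> distinct zeros of \<open>p'\<close>, whose degree is at most
  \<open>4l\<close>.  Since \<open>p'\<close> is not zero, the degree of \<open>p\<close> is exactly \<open>4l + 1\<close>, these are the only
  zeros of \<open>p'\<close>, and all of them are simple (\<open>degree_p\<close>, \<open>p'_eq_0_iff\<close>, \<open>p''_crit\<close>).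

  For the signs, write \<open>p = x N\<^sup>2 g\<close> with \<open>N\<close> the product of the factors \<open>x - a i\<close>.  A zero of \<open>g\<close> in
  \<open>[0, 1/2]\<close> would be a further zero of \<open>p\<close>, hence, by Rolle, a critical point too many, or
  it would make \<open>0\<close> a double or some \<open>a i\<close> a triple zero of \<open>p\<close>, contradicting the list of critical points.
  As \<open>p (1/2) = 1/2\<close> by symmetry, \<open>g > 0\<close> on \<open>[0, 1/2]\<close> (\<open>cofactor\<close>).  This gives \<open>p \<ge> 0\<close> there and
  \<open>p' (0) > 0\<close>, and the latter sign persists on the whole negative axis, where \<open>p'\<close> has no zero.
\<close>

section \<open>Interpolation of values and derivatives\<close>

definition nodal :: "'a::field set \<Rightarrow> 'a poly" where
  "nodal S = (\<Prod>s\<in>S. [:- s, 1:])"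

lemma nodal_insert:
  assumes "finite S" "s \<notin> S"
  shows "nodal (insert s S) = [:- s, 1:] * nodal S"
  using assms by (simp add: nodal_def)

lemma poly_nodal_eq_0_iff:
  assumes "finite S"
  shows "poly (nodal S) x = 0 \<longleftrightarrow> x \<in> S"
  using assms by (auto simp: nodal_def poly_prod)

lemma degree_nodal:
  assumes "finite S"
  shows "degree (nodal S) = card S"
  using assms by (simp add: nodal_def degree_prod_eq_sum_degree)

lemma pderiv_nodal_nonzero:
  assumes "finite S" "s \<in> S"
  shows "poly (pderiv (nodal S)) s \<noteq> 0"
proof -
  have "nodal S = [:- s, 1:] * nodal (S - {s})"
    using assms nodal_insert[of "S - {s}" s] by (simp add: insert_absorb)
  then have "poly (pderiv (nodal S)) s = poly (nodal (S - {s})) s"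
    by (simp add: pderiv_mult pderiv_pCons del: mult_pCons_left)
  then show ?thesis
    using assms by (simp add: poly_nodal_eq_0_iff)
qed

lemma nodal_dvd:
  assumes "finite S" "\<And>s. s \<in> S \<Longrightarrow> poly p s = 0"
  shows "nodal S dvd p"
  using assms
proof (induction S arbitrary: p rule: finite_induct)
  case empty
  then show ?case by (simp add: nodal_def)
next
  case (insert s S)
  then have "[:- s, 1:] dvd p"
    by (simp add: poly_eq_0_iff_dvd)
  then obtain q where q: "p = [:- s, 1:] * q"
    by (elim dvdE)
  have "poly q t = 0" if "t \<in> S" for t
  proof -
    have "(t - s) * poly q t = 0"
      using insert.prems[of t] that by (simp add: q algebra_simps)
    then show ?thesis
      using that insert.hyps by auto
  qed
  then have "nodal S dvd q"
    by (rule insert.IH)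
  then show ?case
    unfolding q nodal_insert[OF insert.hyps] by (rule mult_dvd_mono[OF dvd_refl])
qed

text \<open>
  The zeros of \<open>nodal S\<close> are simple.  Hence, after splitting off \<open>nodal S\<close>, the vanishing of the derivative
  at a point of \<open>D\<close> says that the cofactor vanishes there, and \<open>nodal D\<close> can be split off as well.
\<close>

lemma nodal_mult_nodal_dvd:
  assumes S: "finite S" and D: "D \<subseteq> S"
    and p: "\<And>s. s \<in> S \<Longrightarrow> poly p s = 0"
    and p': "\<And>d. d \<in> D \<Longrightarrow> poly (pderiv p) d = 0"
  shows "nodal S * nodal D dvd p"
proof -
  have "nodal S dvd p"
    using S p by (rule nodal_dvd)
  then obtain r where r: "p = nodal S * r"
    by (elim dvdE)
  have "poly r d = 0" if "d \<in> D" for d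
  proof -
    have "poly (pderiv (nodal S)) d * poly r d = 0"
      using p'[OF that] that D S poly_nodal_eq_0_iff[OF S, of d]
      by (simp add: r pderiv_mult subset_iff mult.commute)
    then show ?thesis
      using pderiv_nodal_nonzero[OF S] that D by auto
  qed
  then have "nodal D dvd r"
    using nodal_dvd finite_subset[OF D S] by blast
  then show ?thesis
    unfolding r by (rule mult_dvd_mono[OF dvd_refl])
qed

lemma poly_eq_0_by_counting_zeros:
  fixes p :: "'a::field poly"
  assumes S: "finite S" and D: "D \<subseteq> S"
    and p: "\<And>s. s \<in> S \<Longrightarrow> poly p s = 0"
    and p': "\<And>d. d \<in> D \<Longrightarrow> poly (pderiv p) d = 0"
    and deg: "degree p < card S + card D"
  shows "p = 0"
proof (rule ccontr)
  assume "p \<noteq> 0"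
  have D_fin: "finite D"
    using finite_subset[OF D S] .
  have "nodal S \<noteq> 0" "nodal D \<noteq> 0"
    using S D_fin by (simp_all add: nodal_def)
  then have "degree (nodal S * nodal D) = card S + card D"
    using S D_fin by (simp add: degree_mult_eq degree_nodal)
  moreover have "degree (nodal S * nodal D) \<le> degree p"
    using dvd_imp_degree_le[OF nodal_mult_nodal_dvd[OF S D p p'] \<open>p \<noteq> 0\<close>] .
  ultimately show False
    using deg by simp
qed

lemma lagrange_interpolation_exists:
  fixes f :: "'a::field \<Rightarrow> 'a"
  assumes "finite S"
  shows "\<exists>p. degree p \<le> card S - 1 \<and> (\<forall>s\<in>S. poly p s = f s)"
  using assms
proof (induction S rule: finite_induct)
  case empty
  show ?case by (rule exI[of _ 0]) simp
next
  case (insert s S)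
  then obtain p where p: "degree p \<le> card S - 1" "\<forall>t\<in>S. poly p t = f t"
    by blast
  have ne: "poly (nodal S) s \<noteq> 0"
    using insert.hyps by (simp add: poly_nodal_eq_0_iff)
  let ?q = "p + smult ((f s - poly p s) / poly (nodal S) s) (nodal S)"
  have "degree ?q \<le> card S"
  proof (rule degree_add_le)
    show "degree p \<le> card S"
      using p(1) by simp
  qed (use degree_nodal[OF insert.hyps(1)] in simp)
  moreover have "poly ?q t = f t" if "t \<in> insert s S" for t
    using that p(2) ne insert.hyps poly_nodal_eq_0_iff[OF insert.hyps(1), of t] by auto
  ultimately show ?case
    using insert.hyps by (intro exI[of _ ?q]) simp
qed

text \<open>
  A multiple \<open>nodal S * r\<close> can be added to a Lagrange interpolant without disturbing its values on \<open>S\<close>.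
  It changes the derivative at \<open>d\<close> by \<open>r d\<close> times a nonzero number, so that the derivatives are
  adjusted by solving a second Lagrange problem, for \<open>r\<close>, on \<open>D\<close>.
\<close>

lemma hermite_interpolation_exists:
  fixes f g :: "'a::field \<Rightarrow> 'a"
  assumes S: "finite S" and D: "D \<subseteq> S"
  shows "\<exists>p. degree p \<le> card S + card D - 1 \<and>
    (\<forall>s\<in>S. poly p s = f s) \<and> (\<forall>d\<in>D. poly (pderiv p) d = g d)"
proof -
  obtain q where q: "degree q \<le> card S - 1" "\<forall>s\<in>S. poly q s = f s"
    using lagrange_interpolation_exists[OF S] by blast
  obtain r where r: "degree r \<le> card D - 1"
      "\<forall>d\<in>D. poly r d = (g d - poly (pderiv q) d) / poly (pderiv (nodal S)) d"
    using lagrange_interpolation_exists[OF finite_subset[OF D S],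
        of "\<lambda>d. (g d - poly (pderiv q) d) / poly (pderiv (nodal S)) d"] by blast
  show ?thesis
  proof (cases "D = {}")
    case True
    then show ?thesis using q by auto
  next
    case False
    then have D_pos: "card D \<ge> 1"
      using finite_subset[OF D S] by (simp add: Suc_le_eq card_gt_0_iff)
    let ?p = "q + nodal S * r"
    have "degree ?p \<le> card S + card D - 1"
    proof (rule degree_add_le)
      show "degree q \<le> card S + card D - 1"
        using q(1) by simp
      show "degree (nodal S * r) \<le> card S + card D - 1"
        using degree_mult_le[of "nodal S" r] r(1) D_pos degree_nodal[OF S] by linarith
    qed
    moreover have "poly ?p s = f s" if "s \<in> S" for s
      using that q(2) S by (simp add: poly_nodal_eq_0_iff)
    moreover have "poly (pderiv ?p) d = g d" if "d \<in> D" for d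
    proof -
      have "d \<in> S" using that D by blast
      then show ?thesis
        using that r(2) pderiv_nodal_nonzero[OF S, of d] poly_nodal_eq_0_iff[OF S, of d]
        by (simp add: pderiv_add pderiv_mult)
    qed
    ultimately show ?thesis by blast
  qed
qed

lemma poly_pos_spreads:
  fixes q :: "real poly"
  assumes "poly q x > 0" "\<And>t. min x y \<le> t \<Longrightarrow> t \<le> max x y \<Longrightarrow> poly q t \<noteq> 0"
  shows "poly q y > 0"
proof (rule ccontr)
  assume "\<not> poly q y > 0"
  with assms(2)[of y] have neg: "poly q y < 0" by fastforce
  consider "x < y" | "y < x" | "x = y" by linarith
  then show False
  proof cases
    case 1
    then show False using poly_IVT_neg[OF 1 assms(1) neg] assms(2) by fastforce
  next
    case 2
    then show False using poly_IVT_pos[OF 2 neg assms(1)] assms(2) by fastforce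
  qed (use assms(1) neg in auto)
qed

lemma poly_rolle:
  fixes p :: "real poly"
  assumes "x < y" "poly p x = poly p y"
  obtains z where "x < z" "z < y" "poly (pderiv p) z = 0"
  using poly_MVT[OF assms(1), of p] assms by auto

section \<open>Reflection about one half\<close>

lemma card_union_reflection:
  fixes B :: "real set"
  assumes "\<And>x. x \<in> B \<Longrightarrow> x < 1 / 2" "finite B"
  shows "card (B \<union> (\<lambda>x. 1 - x) ` B) = 2 * card B"
proof -
  have "B \<inter> (\<lambda>x. 1 - x) ` B = {}"
  proof (rule equals0I)
    fix x
    assume "x \<in> B \<inter> (\<lambda>x. 1 - x) ` B"
    then obtain y where "x \<in> B" "y \<in> B" "x = 1 - y" by blast
    then show False
      using assms(1)[of x] assms(1)[of y] by simp
  qed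
  moreover have "card ((\<lambda>x. 1 - x) ` B) = card B"
    by (intro card_image inj_onI) simp
  ultimately show ?thesis
    using assms(2) by (simp add: card_Un_disjoint)
qed

lemma pderiv_reflect:
  fixes p :: "real poly"
  shows "poly (pderiv (pcompose p [:1, -1:])) x = - poly (pderiv p) (1 - x)"
  by (simp add: pderiv_pcompose pderiv_pCons poly_pcompose)

lemma pderiv_symmetric:
  fixes p :: "real poly"
  assumes "\<And>x. poly p x + poly p (1 - x) = 1"
  shows "poly (pderiv p) (1 - x) = poly (pderiv p) x"
proof -
  have "p + pcompose p [:1, -1:] = 1"
    using assms by (intro poly_eq_poly_eq_iff[THEN iffD1] ext) (simp add: poly_pcompose)
  then have "poly (pderiv (p + pcompose p [:1, -1:])) x = 0"
    by simp
  then show ?thesis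
    unfolding pderiv_add poly_add pderiv_reflect by simp
qed

section \<open>Existence and uniqueness of the interpolant\<close>

text \<open>
  Setting \<open>a 0 = 0\<close> makes the simple node \<open>0\<close> the left end of the first gap, so that the interval
  \<open>(0, a 1)\<close> needs no separate treatment.
\<close>

locale left_half_nodes =
  fixes l :: nat and a :: "nat \<Rightarrow> real"
  assumes a_0: "a 0 = 0"
    and a_less_Suc: "i < l \<Longrightarrow> a i < a (Suc i)"
    and a_l: "a l < 1 / 2"
begin

abbreviation A :: "real set" where "A \<equiv> a ` {1..l}"

lemma a_less: "i < j \<Longrightarrow> j \<le> l \<Longrightarrow> a i < a j"
proof (induction j)
  case (Suc j)
  then show ?case
    using a_less_Suc[of j] by (cases "i = j") auto
qed simp

lemma a_le: "i \<le> j \<Longrightarrow> j \<le> l \<Longrightarrow> a i \<le> a j"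
  using a_less[of i j] by (cases "i = j") auto

lemma A_bounds: "x \<in> A \<Longrightarrow> 0 < x \<and> x < 1 / 2"
  using a_less[of 0] a_le[of _ l] a_0 a_l by fastforce

lemma card_A: "card A = l"
proof -
  have "inj_on a {1..l}"
    by (rule linorder_inj_onI) (use a_less in fastforce)+
  then show ?thesis by (simp add: card_image)
qed

text \<open>
  The gap containing \<open>x\<close> ends at the least node that is not below \<open>x\<close>.
\<close>

lemma node_cases:
  assumes "0 < x" "x \<notin> A"
  obtains (between) i where "i < l" "a i < x" "x < a (Suc i)" | (beyond) "a l < x"
proof (cases "a l < x")
  case False
  have "\<exists>k\<le>l. x \<le> a k"
    using False by (intro exI[of _ l]) auto
  then obtain k where k: "k \<le> l" "x \<le> a k" and least: "\<forall>j<k. \<not> (j \<le> l \<and> x \<le> a j)"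
    using exists_least_iff[of "\<lambda>k. k \<le> l \<and> x \<le> a k"] by blast
  have "k \<noteq> 0"
    using k assms a_0 by (intro notI) auto
  then obtain i where i: "k = Suc i"
    using not0_implies_Suc by blast
  have "x \<noteq> a k"
    using assms(2) k \<open>k \<noteq> 0\<close> by auto
  then show ?thesis
    using between[of i] k least i by fastforce
qed

definition nodes :: "real set" where
  "nodes = insert 0 A \<union> (\<lambda>x. 1 - x) ` insert 0 A"

definition double_nodes :: "real set" where
  "double_nodes = A \<union> (\<lambda>x. 1 - x) ` A"

lemma nodes_facts:
  "finite nodes" "double_nodes \<subseteq> nodes" "card nodes + card double_nodes = 4 * l + 2"
proof -
  have "0 \<notin> A" using A_bounds by fastforce
  then have "card (insert 0 A) = l + 1"
    using card_A by simp
  moreover have "card nodes = 2 * card (insert 0 A)"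
    unfolding nodes_def by (rule card_union_reflection) (use A_bounds in auto)
  moreover have "card double_nodes = 2 * card A"
    unfolding double_nodes_def by (rule card_union_reflection) (use A_bounds in auto)
  ultimately show "card nodes + card double_nodes = 4 * l + 2"
    using card_A by simp
qed (auto simp: nodes_def double_nodes_def)

lemma interpolation_unique:
  assumes "\<And>s. s \<in> nodes \<Longrightarrow> poly p s = poly q s"
    and "\<And>d. d \<in> double_nodes \<Longrightarrow> poly (pderiv p) d = poly (pderiv q) d"
    and "degree p \<le> 4 * l + 1" "degree q \<le> 4 * l + 1"
  shows "p = q"
proof -
  have "degree (p - q) \<le> 4 * l + 1"
    using assms(3,4) by (rule degree_diff_le)
  then have "p - q = 0"
    using assms(1,2) nodes_facts
    by (intro poly_eq_0_by_counting_zeros[of nodes double_nodes]) (auto simp: pderiv_diff)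
  then show ?thesis by simp
qed

text \<open>
  The degree is only bounded here: that is what interpolation yields and what uniqueness uses.  That
  the bound is attained follows later from the number of critical points.
\<close>

definition interpolates :: "real poly \<Rightarrow> bool" where
  "interpolates p \<longleftrightarrow> degree p \<le> 4 * l + 1 \<and>
     (\<forall>x. poly p x + poly p (1 - x) = 1) \<and>
     poly p 0 = 0 \<and> (\<forall>x\<in>A. poly p x = 0 \<and> poly (pderiv p) x = 0)"

text \<open>
  The Hermite data are chosen to be compatible with the symmetry: the value is \<open>0\<close> at nodes in the left
  half and \<open>1\<close> at nodes in the right half.  Then \<open>1 - p (1 - x)\<close> interpolates the same data, and
  uniqueness turns this into \<open>p x + p (1 - x) = 1\<close>.
\<close>

lemma interpolates_exists: "\<exists>p. interpolates p"
proof -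
  obtain p where deg: "degree p \<le> 4 * l + 1"
    and val: "\<And>s. s \<in> nodes \<Longrightarrow> poly p s = (if s < 1 / 2 then 0 else 1)"
    and der: "\<And>d. d \<in> double_nodes \<Longrightarrow> poly (pderiv p) d = 0"
    using hermite_interpolation_exists[OF nodes_facts(1,2),
        of "\<lambda>s. if s < 1 / 2 then 0 else 1" "\<lambda>_. 0"] nodes_facts(3) by auto
  let ?q = "1 - pcompose p [:1, -1:]"
  have "degree ?q \<le> 4 * l + 1"
    using deg by (intro degree_diff_le) (auto simp: degree_pcompose)
  moreover have "1 - s \<in> nodes" "s \<noteq> 1 / 2" if "s \<in> nodes" for s
    using that A_bounds by (fastforce simp: nodes_def)+
  then have "poly p s = poly ?q s" if "s \<in> nodes" for s
    using that val[of s] val[of "1 - s"] by (auto simp: poly_pcompose)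
  moreover have "1 - d \<in> double_nodes" if "d \<in> double_nodes" for d
    using that by (force simp: double_nodes_def)
  then have "poly (pderiv p) d = poly (pderiv ?q) d" if "d \<in> double_nodes" for d
    using that der[of d] der[of "1 - d"] by (simp add: pderiv_diff pderiv_reflect)
  ultimately have p_eq: "p = ?q"
    using deg by (intro interpolation_unique)
  have "poly p x + poly p (1 - x) = 1" for x
    using arg_cong[OF p_eq, of "\<lambda>q. poly q x"] by (simp add: poly_pcompose)
  moreover have "poly p x = 0" if "x \<in> insert 0 A" for x
    using that val[of x] A_bounds[of x] by (auto simp: nodes_def)
  moreover have "poly (pderiv p) x = 0" if "x \<in> A" for x
    using that der[of x] by (auto simp: double_nodes_def)
  ultimately show ?thesis
    using deg unfolding interpolates_def by blast
qed

lemma interpolates_unique: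
  assumes p: "interpolates p" and q: "interpolates q"
  shows "p = q"
proof (rule interpolation_unique)
  have "poly r s = (if s < 1 / 2 then 0 else 1)" if r: "interpolates r" and s: "s \<in> nodes" for r s
  proof -
    have left: "poly r x = 0" "poly r (1 - x) = 1" "x < 1 / 2" if "x \<in> insert 0 A" for x
    proof -
      show "poly r x = 0"
        using r that unfolding interpolates_def by blast
      moreover have "poly r x + poly r (1 - x) = 1"
        using r unfolding interpolates_def by blast
      ultimately show "poly r (1 - x) = 1" by simp
      show "x < 1 / 2" using that A_bounds[of x] by auto
    qed
    consider "s \<in> insert 0 A" | x where "x \<in> insert 0 A" "s = 1 - x"
      using s unfolding nodes_def by blast
    then show ?thesis
      by cases (use left in fastforce)+
  qed
  then show "poly p s = poly q s" if "s \<in> nodes" for s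
    using p q that by simp
  have "poly (pderiv r) d = 0" if r: "interpolates r" and d: "d \<in> double_nodes" for r d
    using r d pderiv_symmetric[of r] unfolding interpolates_def double_nodes_def by auto
  then show "poly (pderiv p) d = poly (pderiv q) d" if "d \<in> double_nodes" for d
    using p q that by simp
qed (use p q in \<open>auto simp: interpolates_def\<close>)

end

section \<open>Critical points\<close>

locale interpolant = left_half_nodes +
  fixes p :: "real poly"
  assumes interpolates: "interpolates p"
begin

lemma deg: "degree p \<le> 4 * l + 1"
  and reflect: "poly p x + poly p (1 - x) = 1"
  and p_0: "poly p 0 = 0"
  and p_A: "x \<in> A \<Longrightarrow> poly p x = 0"
  and p'_A: "x \<in> A \<Longrightarrow> poly (pderiv p) x = 0"
  using interpolates by (auto simp: interpolates_def)

lemma p_a: "i \<le> l \<Longrightarrow> poly p (a i) = 0"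
  using p_0 p_A[of "a i"] a_0 by (cases i) auto

lemma p_half: "poly p (1 / 2) = 1 / 2"
  using reflect[of "1 / 2"] by simp

lemma p'_nonzero: "pderiv p \<noteq> 0"
proof
  assume "pderiv p = 0"
  then show False
    using poly_MVT[of 0 "1 / 2" p] p_0 p_half by simp
qed

definition rolle_point :: "nat \<Rightarrow> real" where
  "rolle_point i = (SOME x. a i < x \<and> x < a (Suc i) \<and> poly (pderiv p) x = 0)"

lemma rolle_point:
  assumes "i < l"
  shows "a i < rolle_point i" "rolle_point i < a (Suc i)" "poly (pderiv p) (rolle_point i) = 0"
proof -
  have "\<exists>x. a i < x \<and> x < a (Suc i) \<and> poly (pderiv p) x = 0"
    using poly_rolle[OF a_less_Suc[OF assms], of p] assms by (metis Suc_leI p_a less_imp_le)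
  from someI_ex[OF this] show
      "a i < rolle_point i" "rolle_point i < a (Suc i)" "poly (pderiv p) (rolle_point i) = 0"
    by (auto simp: rolle_point_def)
qed

lemma a_between:
  assumes "i < l" "j \<le> l" "a i < x" "x < a (Suc i)"
  shows "x \<noteq> a j"
  using assms a_le[of j i] a_le[of "Suc i" j] by (cases "j \<le> i") auto

lemma gap_unique:
  assumes "i < l" "a i < x" "x < a (Suc i)" "j < l" "a j < x" "x < a (Suc j)"
  shows "i = j"
proof (rule ccontr)
  assume "i \<noteq> j"
  then show False
    using assms a_le[of "Suc i" j] a_le[of "Suc j" i] by (cases "i < j") auto
qed

definition left_crit :: "real set" where
  "left_crit = A \<union> rolle_point ` {..<l}"

definition crit :: "real set" where
  "crit = left_crit \<union> (\<lambda>x. 1 - x) ` left_crit"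

lemma left_crit_bounds:
  assumes "x \<in> left_crit"
  shows "0 < x" "x \<le> a l"
proof -
  consider "x \<in> A" | i where "i < l" "x = rolle_point i"
    using assms by (auto simp: left_crit_def)
  then have "0 < x \<and> x \<le> a l"
  proof cases
    case 1
    then show ?thesis using A_bounds[of x] a_le[of _ l] by auto
  next
    case 2
    then show ?thesis using rolle_point[of i] a_le[of 0 i] a_le[of "Suc i" l] a_0 by auto
  qed
  then show "0 < x" "x \<le> a l" by auto
qed

text \<open>
  The \<open>l\<close> nodes and the \<open>l\<close> Rolle points all lie in the open left half and are distinct; reflection
  doubles their number.  This equals the largest possible degree of \<open>p'\<close>.
\<close>

lemma card_crit: "card crit = 4 * l"
proof -
  have "inj_on rolle_point {..<l}"
    using rolle_point gap_unique by (intro inj_onI) (metis lessThan_iff)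
  then have "card (rolle_point ` {..<l}) = l"
    by (simp add: card_image)
  moreover have "A \<inter> rolle_point ` {..<l} = {}"
    using a_between rolle_point by fastforce
  ultimately have "card left_crit = 2 * l"
    using card_A by (simp add: left_crit_def card_Un_disjoint)
  moreover have "card crit = 2 * card left_crit"
    unfolding crit_def
    by (rule card_union_reflection) (use left_crit_bounds a_l in \<open>force simp: left_crit_def\<close>)+
  ultimately show ?thesis by simp
qed

lemma finite_crit: "finite crit"
  by (simp add: crit_def left_crit_def)

lemma p'_crit:
  assumes "x \<in> crit"
  shows "poly (pderiv p) x = 0"
proof -
  have "poly (pderiv p) y = 0" if "y \<in> left_crit" for y
    using that p'_A rolle_point by (auto simp: left_crit_def)
  then show ?thesis
    using assms pderiv_symmetric[OF reflect] by (auto simp: crit_def)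
qed

lemma degree_p': "degree (pderiv p) \<le> 4 * l"
  using deg by (simp add: degree_pderiv)

lemma degree_p: "degree p = 4 * l + 1"
proof (rule ccontr)
  assume "degree p \<noteq> 4 * l + 1"
  moreover have "degree p \<noteq> 0"
    using p'_nonzero by (simp add: pderiv_eq_0_iff)
  ultimately have "degree (pderiv p) < card crit"
    using deg by (simp add: card_crit degree_pderiv)
  then show False
    using p'_nonzero poly_eq_0_by_counting_zeros[of crit "{}" "pderiv p"]
    by (simp add: finite_crit p'_crit)
qed

lemma p'_eq_0_iff: "poly (pderiv p) x = 0 \<longleftrightarrow> x \<in> crit"
proof
  assume x: "poly (pderiv p) x = 0"
  show "x \<in> crit"
  proof (rule ccontr)
    assume "x \<notin> crit"
    then have "degree (pderiv p) < card (insert x crit)"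
      using degree_p' by (simp add: finite_crit card_crit)
    moreover have "poly (pderiv p) s = 0" if "s \<in> insert x crit" for s
      using that x p'_crit by blast
    ultimately show False
      using p'_nonzero poly_eq_0_by_counting_zeros[of "insert x crit" "{}" "pderiv p"]
      by (simp add: finite_crit)
  qed
qed (rule p'_crit)

text \<open>
  A double zero of \<open>p'\<close> would be the zero number \<open>4l + 1\<close> when counted with multiplicity.
\<close>

lemma p''_crit:
  assumes "x \<in> crit"
  shows "poly (pderiv (pderiv p)) x \<noteq> 0"
proof
  assume "poly (pderiv (pderiv p)) x = 0"
  moreover have "degree (pderiv p) < card crit + card {x}"
    using degree_p' by (simp add: card_crit)
  ultimately show False
    using p'_nonzero assms poly_eq_0_by_counting_zeros[of crit "{x}" "pderiv p"]
    by (auto simp: finite_crit p'_crit)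
qed

lemma p'_zero_in_gap:
  assumes "i < l"
  shows "\<exists>!x. x \<in> {a i<..<a (Suc i)} \<and> poly (pderiv p) x = 0"
proof (rule ex1I[of _ "rolle_point i"])
  fix x
  assume x: "x \<in> {a i<..<a (Suc i)} \<and> poly (pderiv p) x = 0"
  then have "x < 1 / 2"
    using a_le[of "Suc i" l] assms a_l by simp
  then have "x \<in> left_crit"
    using x left_crit_bounds a_l by (force simp: p'_eq_0_iff crit_def)
  moreover have "x \<notin> A"
    using x a_between[OF assms, of _ x] by fastforce
  ultimately obtain j where j: "j < l" "x = rolle_point j"
    by (auto simp: left_crit_def)
  then show "x = rolle_point i"
    using gap_unique[of i x j] rolle_point[of j] x assms by auto
qed (use rolle_point[OF assms] in auto)

section \<open>Signs\<close>

text \<open>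
  On average \<open>p\<close> increases from \<open>a l\<close>, where it vanishes, to \<open>1/2\<close>, where it equals \<open>1/2\<close>; and no critical
  point lies in between, since those in the left half are at most \<open>a l\<close>.
\<close>

lemma p'_pos_middle:
  assumes "a l < x" "x \<le> 1 / 2"
  shows "poly (pderiv p) x > 0"
proof -
  obtain y where y: "a l < y" "y < 1 / 2"
    and "poly p (1 / 2) - poly p (a l) = (1 / 2 - a l) * poly (pderiv p) y"
    using poly_MVT[OF a_l] by blast
  then have "(1 / 2 - a l) * poly (pderiv p) y > 0"
    using p_half p_a[of l] by simp
  then have "poly (pderiv p) y > 0"
    using a_l by (simp add: zero_less_mult_iff)
  moreover have "poly (pderiv p) t \<noteq> 0" if "a l < t" "t \<le> 1 / 2" for t
    using that left_crit_bounds a_l by (force simp: p'_eq_0_iff crit_def)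
  ultimately show ?thesis
    using assms y by (intro poly_pos_spreads[of _ y x]) auto
qed

text \<open>
  A further zero inside a gap would split it in two and give two critical points in that gap; a zero
  beyond \<open>a l\<close> would give a critical point beyond \<open>a l\<close>.
\<close>

lemma p_nonzero_off_nodes:
  assumes "0 < x" "x \<le> 1 / 2" "x \<notin> A"
  shows "poly p x \<noteq> 0"
proof
  assume px: "poly p x = 0"
  from assms(1,3) show False
  proof (cases rule: node_cases)
    case (between i)
    obtain u where "a i < u" "u < x" "poly (pderiv p) u = 0"
      using poly_rolle[of "a i" x p] between px p_a[of i] by auto
    moreover obtain v where "x < v" "v < a (Suc i)" "poly (pderiv p) v = 0"
      using poly_rolle[of x "a (Suc i)" p] between px p_a[of "Suc i"] by auto
    ultimately show False
      using p'_zero_in_gap[OF between(1)] between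
      by (metis greaterThanLessThan_iff less_trans less_irrefl)
  next
    case beyond
    obtain u where "a l < u" "u < x" "poly (pderiv p) u = 0"
      using poly_rolle[of "a l" x p] beyond px p_a[of l] by auto
    then show False
      using p'_pos_middle[of u] assms by simp
  qed
qed

text \<open>
  In \<open>[0, 1/2]\<close> the only zeros of \<open>p\<close> are \<open>0\<close> and the \<open>a i\<close>, with multiplicity exactly one and two,
  since \<open>p'\<close> does not vanish at \<open>0\<close> nor \<open>p''\<close> at the \<open>a i\<close>.  So the cofactor \<open>g\<close> has no zero there, and
  its sign is that of \<open>p (1/2) = 1/2\<close>.
\<close>

lemma cofactor:
  obtains g where "p = [:0, 1:] * (nodal A * (nodal A * g))"
    and "\<And>x. 0 \<le> x \<Longrightarrow> x \<le> 1 / 2 \<Longrightarrow> poly g x > 0"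
proof -
  have zero: "0 \<notin> A" using A_bounds by fastforce
  have "nodal (insert 0 A) * nodal A dvd p"
    by (rule nodal_mult_nodal_dvd) (use p_0 p_A p'_A in auto)
  then obtain g where "p = nodal (insert 0 A) * nodal A * g"
    by (elim dvdE)
  moreover have "nodal (insert 0 A) = [:0, 1:] * nodal A"
    using nodal_insert[of A 0] zero by simp
  ultimately have g: "p = [:0, 1:] * (nodal A * (nodal A * g))"
    by (simp only: mult.assoc)
  have nz: "poly g x \<noteq> 0" if "0 \<le> x" "x \<le> 1 / 2" for x
  proof
    assume gx: "poly g x = 0"
    then have px: "poly p x = 0"
      by (simp add: g)
    consider "x = 0" | "x \<in> A" | "x \<noteq> 0" "x \<notin> A" by blast
    then show False
    proof cases
      case 1
      then have "poly (pderiv p) 0 = 0"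
        using gx by (simp add: g pderiv_mult pderiv_pCons)
      then show False
        using left_crit_bounds a_l by (force simp: p'_eq_0_iff crit_def)
    next
      case 2
      then have "poly (nodal A) x = 0"
        by (simp add: poly_nodal_eq_0_iff)
      \<comment> \<open>Three factors of \<open>p\<close> vanish at \<open>x\<close>, so each term of the second derivative keeps one of them.\<close>
      then have "poly (pderiv (pderiv p)) x = 0"
        using gx unfolding g by (simp add: pderiv_mult pderiv_add del: mult_pCons_left)
      then show False
        using p''_crit[of x] 2 by (auto simp: crit_def left_crit_def)
    next
      case 3
      then show False
        using p_nonzero_off_nodes[of x] that px by simp
    qed
  qed
  have "poly (nodal A) (1 / 2) \<noteq> 0"
    using A_bounds[of "1 / 2"] poly_nodal_eq_0_iff[of A "1 / 2"] by fastforce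
  moreover have "poly p (1 / 2) = 1 / 2 * ((poly (nodal A) (1 / 2))\<^sup>2 * poly g (1 / 2))"
    by (simp add: g power2_eq_square)
  ultimately have "poly g (1 / 2) > 0"
    using p_half by (simp add: zero_less_mult_iff) (smt (verit) zero_le_power2 mult_nonneg_nonpos)
  then have "poly g x > 0" if "0 \<le> x" "x \<le> 1 / 2" for x
    using that nz by (intro poly_pos_spreads[of g "1 / 2" x]) auto
  then show ?thesis
    using that g by blast
qed

text \<open>
  By the product rule \<open>p' (0) = N (0)\<^sup>2 g (0) > 0\<close> for the factorization \<open>p = x N\<^sup>2 g\<close> with
  \<open>N = nodal A\<close>, and all critical points are positive.
\<close>

lemma p'_pos_left:
  assumes "x \<le> 0"
  shows "poly (pderiv p) x > 0"
proof -
  obtain g where g: "p = [:0, 1:] * (nodal A * (nodal A * g))"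
    and pos: "\<And>x. 0 \<le> x \<Longrightarrow> x \<le> 1 / 2 \<Longrightarrow> poly g x > 0"
    using cofactor by blast
  have "poly (pderiv p) 0 = (poly (nodal A) 0)\<^sup>2 * poly g 0"
    by (simp add: g pderiv_mult pderiv_pCons power2_eq_square)
  moreover have "poly (nodal A) 0 \<noteq> 0"
    using A_bounds[of 0] poly_nodal_eq_0_iff[of A 0] by fastforce
  ultimately have "poly (pderiv p) 0 > 0"
    using pos[of 0] by simp
  moreover have "poly (pderiv p) t \<noteq> 0" if "t \<le> 0" for t
    using that left_crit_bounds a_l by (force simp: p'_eq_0_iff crit_def)
  ultimately show ?thesis
    using assms by (intro poly_pos_spreads[of _ 0 x]) auto
qed

lemma p_neg_left:
  assumes "x < 0"
  shows "poly p x < 0"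
proof -
  obtain y where "y < 0" "poly p 0 - poly p x = (0 - x) * poly (pderiv p) y"
    using poly_MVT[OF assms] by blast
  then show ?thesis
    using p'_pos_left[of y] assms p_0 mult_neg_pos[of x "poly (pderiv p) y"] by simp
qed

lemma p_sign:
  assumes "0 \<le> x" "x \<le> 1 / 2"
  shows "poly p x \<ge> 0" "poly p x = 0 \<longleftrightarrow> x = 0 \<or> x \<in> A"
proof -
  obtain g where g: "p = [:0, 1:] * (nodal A * (nodal A * g))"
    and pos: "poly g x > 0"
    using cofactor assms by metis
  have "poly p x = x * ((poly (nodal A) x)\<^sup>2 * poly g x)"
    by (simp add: g power2_eq_square)
  then show "poly p x \<ge> 0"
    using assms pos by simp
  show "poly p x = 0 \<longleftrightarrow> x = 0 \<or> x \<in> A"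
    using p_nonzero_off_nodes[of x] assms p_0 p_A by fastforce
qed

end

theorem lemma3p3:
  fixes l :: nat and a :: "nat \<Rightarrow> real"
  assumes "l \<ge> 1"
    and "0 < a 1"
    and "\<forall>i\<in>{1..<l}. a i < a (i + 1)"
    and "a l < 1 / 2"
  shows "(\<exists>!p. reflection_interpolant l a p) \<and>
    (\<forall>p. reflection_interpolant l a p \<longrightarrow>
      ((\<exists>!x. x \<in> {0<..<a 1} \<and> poly (pderiv p) x = 0) \<and>
       (\<forall>i\<in>{1..<l}. \<exists>!x. x \<in> {a i<..<a (i + 1)} \<and> poly (pderiv p) x = 0) \<and>
       (\<forall>x\<in>{a l<..1 / 2}. poly (pderiv p) x > 0) \<and>
       (\<forall>x\<le>0. poly (pderiv p) x > 0)) \<and>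
      ((\<forall>x<0. poly p x < 0) \<and>
       (\<forall>x\<in>{0..1 / 2}. poly p x \<ge> 0 \<and>
          (poly p x = 0 \<longleftrightarrow> x = 0 \<or> (\<exists>i\<in>{1..l}. x = a i)))))"
proof -
  define b where "b = a(0 := 0)"
  have b: "b 0 = 0" "\<And>i. i \<noteq> 0 \<Longrightarrow> b i = a i"
    by (simp_all add: b_def)
  interpret left_half_nodes l b
  proof
    show "b i < b (Suc i)" if "i < l" for i
      using that assms(2,3) by (cases "i = 0") (auto simp: b)
  qed (use assms in \<open>auto simp: b\<close>)
  have A: "b ` {1..l} = a ` {1..l}"
    by (intro image_cong) (auto simp: b)
  have interpolant: "interpolant l b p" if "interpolates p" for p
    by unfold_locales (rule that)
  have iff: "reflection_interpolant l a p \<longleftrightarrow> interpolates p" for p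
  proof
    assume "interpolates p"
    then show "reflection_interpolant l a p"
      using interpolant.degree_p[OF interpolant, of p]
      by (auto simp: reflection_interpolant_def interpolates_def b)
  qed (auto simp: reflection_interpolant_def interpolates_def b)
  have "\<exists>!p. reflection_interpolant l a p"
    unfolding iff using interpolates_exists interpolates_unique by blast
  moreover have "((\<exists>!x. x \<in> {0<..<a 1} \<and> poly (pderiv p) x = 0) \<and>
       (\<forall>i\<in>{1..<l}. \<exists>!x. x \<in> {a i<..<a (i + 1)} \<and> poly (pderiv p) x = 0) \<and>
       (\<forall>x\<in>{a l<..1 / 2}. poly (pderiv p) x > 0) \<and>
       (\<forall>x\<le>0. poly (pderiv p) x > 0)) \<and>
      ((\<forall>x<0. poly p x < 0) \<and>
       (\<forall>x\<in>{0..1 / 2}. poly p x \<ge> 0 \<and>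
          (poly p x = 0 \<longleftrightarrow> x = 0 \<or> (\<exists>i\<in>{1..l}. x = a i))))"
    if "reflection_interpolant l a p" for p
  proof -
    interpret interpolant l b p
      using that by (intro interpolant) (simp add: iff)
    have "\<exists>!x. x \<in> {0<..<a 1} \<and> poly (pderiv p) x = 0"
      using p'_zero_in_gap[of 0] assms(1) by (simp add: b)
    moreover have "\<exists>!x. x \<in> {a i<..<a (i + 1)} \<and> poly (pderiv p) x = 0" if "i \<in> {1..<l}" for i
      using p'_zero_in_gap[of i] that by (simp add: b)
    moreover have "poly (pderiv p) x > 0" if "x \<in> {a l<..1 / 2}" for x
      using p'_pos_middle[of x] that assms(1) by (simp add: b)
    moreover have "poly p x = 0 \<longleftrightarrow> x = 0 \<or> (\<exists>i\<in>{1..l}. x = a i)" if "x \<in> {0..1 / 2}" for x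
      using p_sign(2)[of x] that unfolding A by auto
    ultimately show ?thesis
      using p'_pos_left p_neg_left p_sign(1) by simp
  qed
  ultimately show ?thesis by blast
qed

end
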